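(* Let $g\ge 1$ and $N\ge 1$ be integers, let $N_1(0),\dots,N_g(0)\in\mathbb{N}$ be positive integers with $\sum_{h=1}^gN_h(0)\le N$, let $0<f_1<f_2<\dots<f_g$ be real numbers, and let $(p(t))_{t\in\mathbb{N}_0}$ be the price process of the multi-group model with these parameters and $p(0)>0$. Then for all integers $n\ge1$ and $t\ge0$, $$\begin{aligned}\mathbb{E}\left(\left(\log\frac{p(t)}{p(0)}\right)^n\right)=\sum_{\substack{n_1,\ldots,n_g\in\mathbb{N}_0\\ n_1+\ldots+n_g=n}}\frac{n!}{\prod_{h}n_h!}\prod_{h=1}^g(\log f_h)^{n_h}\sum_{k_1=0}^{n_1}\frac{N_1(0)!}{(N_1(0)-k_1)!}\left\{\begin{matrix}n_1\\ k_1\end{matrix}\right\}\cdots\\ \sum_{k_g=0}^{n_g}\frac{N_g(0)!}{(N_g(0)-k_g)!}\left\{\begin{matrix}n_g\\ k_g\end{matrix}\right\}\sum_{j=0}^{k_1+\ldots+k_g}(-1)^j\binom{k_1+\ldots+k_g}{j}\left(1-\frac{j}{N}\right)^t.\end{aligned}$$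
   Context: $\mathbb{N}$ denotes the positive integers and $\mathbb{N}_0$ the nonnegative integers. The multi-group model: there are $N$ investors, divided at time $t$ into $g$ active groups of sizes $N_1(t),\dots,N_g(t)$ and $N-\sum_hN_h(t)$ inactive investors. The process $(N_1(t),\dots,N_g(t),p(t))_{t\in\mathbb{N}_0}$ starts from deterministic values. At each time $t$, conditionally on the whole history up to time $t$, an investor is chosen uniformly at random among the $N$: with probability $N_h(t)/N$ an investor of group $h$ is chosen, in which case $p(t+1)=f_h\,p(t)$, $N_h(t+1)=N_h(t)-1$ and $N_i(t+1)=N_i(t)$ for $i\ne h$ (the investor becomes inactive); with probability $(N-\sum_hN_h(t))/N$ an inactive investor is chosen and nothing changes. $\left\{\begin{matrix}n\\ k\end{matrix}\right\}$ is the Stirling number of the second kind: the number of partitions of a set of $n$ elements into $k$ nonempty sets (so $\left\{\begin{matrix}0\\ 0\end{matrix}\right\}=1$). For integers $a,l\ge 0$, $\frac{a!}{(a-l)!}$ denotes the falling factorial $a(a-1)\cdots(a-l+1)$, which is $0$ if $l>a$. Convention: $0^0=1$. *)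

theory Defs
  imports "HOL-Probability.Probability" "HOL-Combinatorics.Stirling"
begin

text \<open>
  The groups are indexed by \<open>{1..g}\<close>; \<open>Gsize h t\<close> is the random size of group \<open>h\<close> at
  time \<open>t\<close> and \<open>p t\<close> the random price. Since the process starts from deterministic values, it
  has at each time almost surely one of finitely many histories, so conditioning on the whole history
  up to time \<open>t\<close> is elementary conditioning on the events of positive probability
  \<open>history g Gsize p \<nu> \<pi> t\<close>.

  The event that an investor of group \<open>h\<close> is chosen is identified with the corresponding transition.
  It is written with \<open>Gsize h t \<omega> = Gsize h (t + 1) \<omega> + 1\<close> rather than with the
  truncated subtraction, so that it is impossible when group \<open>h\<close> is empty and the listed
  transitions are pairwise disjoint even if \<open>f h = 1\<close>.
\<close>

definition history ::
    "nat \<Rightarrow> (nat \<Rightarrow> nat \<Rightarrow> 'a \<Rightarrow> nat) \<Rightarrow> (nat \<Rightarrow> 'a \<Rightarrow> real) \<Rightarrow>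
     (nat \<Rightarrow> nat \<Rightarrow> nat) \<Rightarrow> (nat \<Rightarrow> real) \<Rightarrow> nat \<Rightarrow> 'a \<Rightarrow> bool" where
  "history g Gsize p \<nu> \<pi> t \<omega> \<longleftrightarrow>
     (\<forall>s\<le>t. (\<forall>h\<in>{1..g}. Gsize h s \<omega> = \<nu> h s) \<and> p s \<omega> = \<pi> s)"

locale multi_group_model = prob_space M for M :: "'a measure" +
  fixes g N :: nat
    and f :: "nat \<Rightarrow> real"
    and N0 :: "nat \<Rightarrow> nat"
    and p0 :: real
    and Gsize :: "nat \<Rightarrow> nat \<Rightarrow> 'a \<Rightarrow> nat"
    and p :: "nat \<Rightarrow> 'a \<Rightarrow> real"
  assumes measurable_Gsize: "\<And>h t. h \<in> {1..g} \<Longrightarrow> Gsize h t \<in> measurable M (count_space UNIV)"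
    and measurable_p: "\<And>t. p t \<in> borel_measurable M"
    and initial: "AE \<omega> in M. (\<forall>h\<in>{1..g}. Gsize h 0 \<omega> = N0 h) \<and> p 0 \<omega> = p0"
    and active_chosen:
      "\<And>t h \<nu> \<pi>. h \<in> {1..g} \<Longrightarrow> \<P>(\<omega> in M. history g Gsize p \<nu> \<pi> t \<omega>) > 0 \<Longrightarrow>
         \<P>(\<omega> in M. p (t + 1) \<omega> = f h * p t \<omega> \<and>
                    Gsize h t \<omega> = Gsize h (t + 1) \<omega> + 1 \<and>
                    (\<forall>i\<in>{1..g} - {h}. Gsize i (t + 1) \<omega> = Gsize i t \<omega>)
              \<bar> history g Gsize p \<nu> \<pi> t \<omega>)
         = real (\<nu> h t) / real N"
    and inactive_chosen:
      "\<And>t \<nu> \<pi>. \<P>(\<omega> in M. history g Gsize p \<nu> \<pi> t \<omega>) > 0 \<Longrightarrow>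
         \<P>(\<omega> in M. p (t + 1) \<omega> = p t \<omega> \<and>
                    (\<forall>i\<in>{1..g}. Gsize i (t + 1) \<omega> = Gsize i t \<omega>)
              \<bar> history g Gsize p \<nu> \<pi> t \<omega>)
         = (real N - (\<Sum>h=1..g. real (\<nu> h t))) / real N"

definition falling_factorial :: "nat \<Rightarrow> nat \<Rightarrow> real" where
  "falling_factorial a l = (\<Prod>i<l. real a - real i)"

definition weak_compositions :: "nat \<Rightarrow> nat \<Rightarrow> (nat \<Rightarrow> nat) set" where
  "weak_compositions g n = {m \<in> {1..g} \<rightarrow>\<^sub>E UNIV. (\<Sum>h=1..g. m h) = n}"

end

(* Let X_h be the number of investors of group h that have become inactive. Almost surely
   log (p t / p 0) = sum_h X_h log f_h, so by the multinomial theorem and the expansion of powers in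
   falling factorials it suffices to know the joint factorial moments of the X_h.
   In one step X_h increases with probability (N_h(0) - X_h) / N. This generator maps a product of
   falling factorials of orders k_h, with K = sum_h k_h, to a combination of the product itself and the
   products in which one k_h is lowered. By induction on t the moment is
   prod_h N_h(0)!/(N_h(0) - k_h)! times the solution of
     S_{t+1}(K) = (1 - K/N) S_t(K) + (K/N) S_t(K - 1),
   which is the alternating binomial sum. *)
theory Submission
  imports Defs
begin


section \<open>Falling factorials and the Stirling expansion of powers\<close>

definition falling :: "real \<Rightarrow> nat \<Rightarrow> real" where
  "falling x k = (\<Prod>i<k. x - real i)"

lemma falling_0 [simp]: "falling x 0 = 1"
  by (simp add: falling_def)

lemma falling_Suc: "falling x (Suc k) = falling x k * (x - real k)"
  by (simp add: falling_def)

lemma falling_0_left: "falling 0 k = of_bool (k = 0)"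
  by (cases k) (auto simp: falling_def)

text \<open>Discrete analogue of the derivative of a power: both falling factorials share the
  factors from \<open>x\<close> down to \<open>x - k + 2\<close>, and the remaining factors
  \<open>x + 1\<close> and \<open>x - k + 1\<close> differ by \<open>k\<close>. At
  \<open>k = 0\<close> the factor \<open>real k\<close> makes the truncated \<open>k - 1\<close>
  harmless.\<close>

lemma falling_step_up:
  "falling (x + 1) k = falling x k + real k * falling x (k - 1)"
proof (induction k)
  case (Suc k)
  show ?case
  proof (cases k)
    case (Suc l)
    with Suc.IH show ?thesis by (simp add: falling_Suc algebra_simps)
  qed (simp add: falling_Suc)
qed simp

lemma falling_absorb:
  "real k * falling x (k - 1) * (x - (real k - 1)) = real k * falling x k"
  by (cases k) (auto simp: falling_Suc)

text \<open>Multiplying by \<open>x = (x - k) + k\<close> either raises the order of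
  \<open>falling x k\<close> or multiplies it by \<open>k\<close>, which is the recursion of the
  Stirling numbers.\<close>

lemma power_eq_sum_Stirling_falling:
  "x ^ n = (\<Sum>k\<le>n. real (Stirling n k) * falling x k)"
proof (induction n)
  case (Suc n)
  have "x ^ Suc n = (\<Sum>k\<le>n. real (Stirling n k) * falling x k) * x"
    using Suc by simp
  also have "\<dots> = (\<Sum>k\<le>n. real (Stirling n k) * falling x (Suc k)) +
      (\<Sum>k\<le>n. real k * real (Stirling n k) * falling x k)"
    by (simp add: sum_distrib_left falling_Suc algebra_simps flip: sum.distrib)
  \<comment> \<open>The added term has \<open>Stirling n (Suc n) = 0\<close>; it makes room for the
    index shift, whose term \<open>k = 0\<close> vanishes as well.\<close>
  also have "(\<Sum>k\<le>n. real k * real (Stirling n k) * falling x k) =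
      (\<Sum>k\<le>Suc n. real k * real (Stirling n k) * falling x k)"
    by simp
  also have "\<dots> = (\<Sum>k\<le>n. real (Suc k) * real (Stirling n (Suc k)) * falling x (Suc k))"
    by (subst sum.atMost_Suc_shift) simp
  also have "(\<Sum>k\<le>n. real (Stirling n k) * falling x (Suc k)) + \<dots> =
      (\<Sum>k\<le>n. real (Stirling (Suc n) (Suc k)) * falling x (Suc k))"
    by (simp add: algebra_simps flip: sum.distrib)
  also have "\<dots> = (\<Sum>k\<le>Suc n. real (Stirling (Suc n) k) * falling x k)"
    by (subst sum.atMost_Suc_shift) simp
  finally show ?case .
qed simp

section \<open>The multinomial theorem\<close>

text \<open>Division by \<open>fact n\<close> absorbs the multinomial coefficients into the factors,
  so that adjoining an element is a convolution given by the binomial theorem.\<close>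

lemma multinomial_divided:
  fixes a :: "'b \<Rightarrow> 'c::field_char_0"
  assumes "finite A"
  shows "(\<Sum>h\<in>A. a h) ^ n / fact n =
    (\<Sum>m\<in>{m \<in> A \<rightarrow>\<^sub>E UNIV. sum m A = n}. \<Prod>h\<in>A. a h ^ m h / fact (m h))"
  using assms
proof (induction A arbitrary: n rule: finite_induct)
  case empty
  have "{m \<in> {} \<rightarrow>\<^sub>E UNIV. sum m {} = n} = (if n = 0 then {\<lambda>x::'b. undefined} else {})"
    by auto
  then show ?case by simp
next
  case (insert x A)
  define C where "C B k = {m \<in> B \<rightarrow>\<^sub>E (UNIV::nat set). sum m B = k}" for B :: "'b set" and k
  \<comment> \<open>Every entry is at most the total \<open>k\<close>, which confines
    \<open>C A k\<close> to a finite box.\<close>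
  have fin: "finite (C A k)" for k
  proof (rule finite_subset)
    show "C A k \<subseteq> A \<rightarrow>\<^sub>E {..k}"
      using insert.hyps(1) by (auto simp: C_def PiE_iff extensional_def intro: member_le_sum)
  qed (use insert in \<open>auto intro: finite_PiE\<close>)
  have "(\<Sum>h\<in>insert x A. a h) ^ n / fact n
      = (\<Sum>i\<le>n. of_nat (n choose i) * a x ^ i * (\<Sum>h\<in>A. a h) ^ (n - i) / fact n)"
    using insert by (simp add: binomial_ring sum_divide_distrib)
  also have "\<dots> = (\<Sum>i\<le>n. a x ^ i / fact i * ((\<Sum>h\<in>A. a h) ^ (n - i) / fact (n - i)))"
    by (intro sum.cong) (auto simp: binomial_fact)
  also have "\<dots> = (\<Sum>i\<le>n. \<Sum>m\<in>C A (n - i). a x ^ i / fact i * (\<Prod>h\<in>A. a h ^ m h / fact (m h)))"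
    by (simp only: insert.IH C_def sum_distrib_left)
  also have "\<dots> = (\<Sum>(i, m)\<in>(SIGMA i:{..n}. C A (n - i)). a x ^ i / fact i * (\<Prod>h\<in>A. a h ^ m h / fact (m h)))"
    using fin by (simp add: sum.Sigma)
  also have "\<dots> = (\<Sum>m\<in>C (insert x A) n. \<Prod>h\<in>insert x A. a h ^ m h / fact (m h))"
  \<comment> \<open>The exponent of \<open>x\<close> is split off; resetting it to
    \<open>undefined\<close> keeps the remaining function extensional on \<open>A\<close>.\<close>
  proof (rule sum.reindex_bij_witness[of _ "\<lambda>m. (m x, m(x := undefined))" "\<lambda>(i, m). m(x := i)"])
    fix b assume b: "b \<in> (SIGMA i:{..n}. C A (n - i))"
    obtain i m where im: "b = (i, m)" by force
    have *: "sum (m(x := i)) A = sum m A" "(\<Prod>h\<in>A. a h ^ (m(x := i)) h / fact ((m(x := i)) h)) = (\<Prod>h\<in>A. a h ^ m h / fact (m h))"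
      using insert by (auto intro!: sum.cong prod.cong)
    show "(\<lambda>m. (m x, m(x := undefined))) (case b of (i, m) \<Rightarrow> m(x := i)) = b"
      using b insert im by (auto simp: C_def PiE_iff extensional_def)
    show "(case b of (i, m) \<Rightarrow> m(x := i)) \<in> C (insert x A) n"
      using b insert im * by (auto simp: C_def PiE_iff extensional_def)
    show "(\<Prod>h\<in>insert x A. a h ^ (case b of (i, m) \<Rightarrow> m(x := i)) h / fact ((case b of (i, m) \<Rightarrow> m(x := i)) h))
      = (case b of (i, m) \<Rightarrow> a x ^ i / fact i * (\<Prod>h\<in>A. a h ^ m h / fact (m h)))"
      using insert im * by simp
  next
    fix m assume m: "m \<in> C (insert x A) n"
    have "sum (m(x := undefined)) A = sum m A" using insert by (auto intro!: sum.cong)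
    then show "(m x, m(x := undefined)) \<in> (SIGMA i:{..n}. C A (n - i))"
      using m insert by (auto simp: C_def PiE_iff extensional_def)
  qed auto
  finally show ?case by (simp add: C_def)
qed

section \<open>The alternating binomial sum\<close>

text \<open>For \<open>1 \<le> N\<close> and \<open>K \<le> N\<close> this is, by
  inclusion-exclusion, the probability that \<open>K\<close> given investors out of \<open>N\<close>
  all occur among \<open>t\<close> uniform draws.\<close>

definition thinning :: "nat \<Rightarrow> nat \<Rightarrow> nat \<Rightarrow> real" where
  "thinning N t K = (\<Sum>j\<le>K. (-1) ^ j * real (K choose j) * (1 - real j / real N) ^ t)"

lemma thinning_0: "thinning N 0 K = of_bool (K = 0)"
proof (cases "K = 0")
  case False
  then show ?thesis
    using choose_alternating_sum[of K, where ?'a = real] by (simp add: thinning_def)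
qed (simp add: thinning_def)

text \<open>The additional factor \<open>1 - j/N\<close> splits as
  \<open>(1 - K/N) + (K - j)/N\<close>, and \<open>K - j\<close> is absorbed into the binomial
  coefficient, lowering \<open>K\<close> by one.\<close>

lemma thinning_Suc:
  "thinning N (Suc t) K = (1 - real K / real N) * thinning N t K + real K / real N * thinning N t (K - 1)"
proof -
  let ?q = "\<lambda>j. (1 - real j / real N) ^ t"
  \<comment> \<open>The new term \<open>j = K\<close> is zero, and both sums then have the same
    range.\<close>
  have shrink: "thinning N t (K - 1) = (\<Sum>j\<le>K. (-1) ^ j * real ((K - 1) choose j) * ?q j)" if "K > 0"
    using that by (cases K) (simp_all add: thinning_def)
  have "real (K - j) * real (K choose j) = real K * real ((K - 1) choose j)" for j
    using binomial_absorb_comp[of K j] by (metis of_nat_mult)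
  then have absorb: "(real K - real j) * real (K choose j) = real K * real ((K - 1) choose j)" if "j \<le> K" for j
    using that by (metis of_nat_diff)
  have "thinning N (Suc t) K - (1 - real K / real N) * thinning N t K
      = (\<Sum>j\<le>K. (-1) ^ j * ((real K - real j) * real (K choose j)) * ?q j / real N)"
    by (simp add: thinning_def sum_distrib_left algebra_simps diff_divide_distrib add_divide_distrib flip: sum_subtractf)
  also have "\<dots> = (\<Sum>j\<le>K. real K / real N * ((-1) ^ j * real ((K - 1) choose j) * ?q j))"
    by (intro sum.cong) (auto simp: absorb)
  also have "\<dots> = real K / real N * thinning N t (K - 1)"
    using shrink by (cases "K = 0") (simp_all add: sum_distrib_left sum_divide_distrib)
  finally show ?thesis by simp
qed

section \<open>The generator on products of falling factorials\<close>

text \<open>Here \<open>b\<close> stands for the initial sizes and \<open>x\<close> for the numbers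
  that have left. A step in \<open>h\<close> affects one factor only, so the claim reduces to one
  coordinate.\<close>

lemma falling_sum_generator:
  fixes x b :: "'b \<Rightarrow> real" and k :: "'b \<Rightarrow> nat"
  assumes "finite A"
  shows "(\<Sum>h\<in>A. (b h - x h) * ((\<Prod>i\<in>A. falling ((x(h := x h + 1)) i) (k i)) - (\<Prod>i\<in>A. falling (x i) (k i)))) =
     (\<Sum>h\<in>A. real (k h) * (b h - (real (k h) - 1)) * (\<Prod>i\<in>A. falling (x i) ((k(h := k h - 1)) i)))
     - real (sum k A) * (\<Prod>i\<in>A. falling (x i) (k i))"
proof -
  have "(b h - x h) * ((\<Prod>i\<in>A. falling ((x(h := x h + 1)) i) (k i)) - (\<Prod>i\<in>A. falling (x i) (k i))) =
     real (k h) * (b h - (real (k h) - 1)) * (\<Prod>i\<in>A. falling (x i) ((k(h := k h - 1)) i))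
     - real (k h) * (\<Prod>i\<in>A. falling (x i) (k i))" if h: "h \<in> A" for h
  proof -
    let ?R = "\<Prod>i\<in>A - {h}. falling (x i) (k i)"
    have 1: "(\<Prod>i\<in>A. falling ((x(h := x h + 1)) i) (k i)) = falling (x h + 1) (k h) * ?R"
      "(\<Prod>i\<in>A. falling (x i) ((k(h := k h - 1)) i)) = falling (x h) (k h - 1) * ?R"
      "(\<Prod>i\<in>A. falling (x i) (k i)) = falling (x h) (k h) * ?R"
      using assms h by (auto simp: prod.remove[of A h] intro!: prod.cong)
    \<comment> \<open>Write \<open>b - x = (b - (k - 1)) - (x - (k - 1))\<close>; by
      \<open>falling_absorb\<close> the second part restores the order \<open>k\<close>.\<close>
    have "(b h - x h) * (falling (x h + 1) (k h) - falling (x h) (k h)) =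
      real (k h) * (b h - (real (k h) - 1)) * falling (x h) (k h - 1) - real (k h) * falling (x h) (k h)"
      unfolding falling_absorb[symmetric] falling_step_up by (simp add: algebra_simps)
    then have "(b h - x h) * (falling (x h + 1) (k h) - falling (x h) (k h)) * ?R =
      (real (k h) * (b h - (real (k h) - 1)) * falling (x h) (k h - 1) - real (k h) * falling (x h) (k h)) * ?R"
      by simp
    then show ?thesis unfolding 1 by (simp add: algebra_simps)
  qed
  then show ?thesis by (simp add: sum_subtractf sum_distrib_right)
qed


section \<open>Histories, transitions and their probabilities\<close>

context multi_group_model
begin

text \<open>Freezing the history at 0 after time \<open>t\<close> and outside the groups gives each history a unique
  representative, so that the events \<open>hist t \<omega> = c\<close> are disjoint.\<close>

definition hist :: "nat \<Rightarrow> 'a \<Rightarrow> (nat \<Rightarrow> nat \<Rightarrow> nat) \<times> (nat \<Rightarrow> real)" where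
  "hist t \<omega> = ((\<lambda>h s. if h \<in> {1..g} \<and> s \<le> t then Gsize h s \<omega> else 0), (\<lambda>s. if s \<le> t then p s \<omega> else 0))"

text \<open>The index 0 stands for the choice of an inactive investor, here and in \<open>rate\<close> and \<open>sell\<close>.\<close>

definition chosen :: "nat \<Rightarrow> nat \<Rightarrow> 'a \<Rightarrow> bool" where
  "chosen h t \<omega> \<longleftrightarrow> p (t + 1) \<omega> = (if h = 0 then 1 else f h) * p t \<omega> \<and>
     (\<forall>i\<in>{1..g}. Gsize i t \<omega> = Gsize i (t + 1) \<omega> + of_bool (i = h))"

text \<open>Real subtraction makes a step add exactly 1 even at outcomes where a group exceeds its
  initial size.\<close>

definition sold :: "nat \<Rightarrow> 'a \<Rightarrow> nat \<Rightarrow> real" where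
  "sold t \<omega> = (\<lambda>h\<in>{1..g}. real (N0 h) - real (Gsize h t \<omega>))"

definition rate :: "nat \<Rightarrow> (nat \<Rightarrow> real) \<Rightarrow> real" where
  "rate h x = (if h = 0 then real N - (\<Sum>i=1..g. real (N0 i) - x i) else real (N0 h) - x h) / real N"

definition sell :: "nat \<Rightarrow> (nat \<Rightarrow> real) \<Rightarrow> nat \<Rightarrow> real" where
  "sell h x = (if h = 0 then x else x(h := x h + 1))"

lemma sum_rate: "N \<ge> 1 \<Longrightarrow> (\<Sum>h\<le>g. rate h x) = 1"
proof -
  assume N: "N \<ge> 1"
  have "(\<Sum>h\<le>g. rate h x) = rate 0 x + (\<Sum>h=1..g. rate h x)"
    by (simp add: sum.atMost_Suc_shift sum.atLeast_Suc_atMost flip: atLeast0AtMost)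
  also have "(\<Sum>h=1..g. rate h x) = (\<Sum>h=1..g. real (N0 h) - x h) / real N"
    unfolding sum_divide_distrib by (intro sum.cong) (auto simp: rate_def)
  finally show ?thesis using N by (simp add: rate_def diff_divide_distrib)
qed

lemma hist_eq_iff: "hist t \<omega> = hist t \<omega>' \<longleftrightarrow> history g Gsize p (fst (hist t \<omega>')) (snd (hist t \<omega>')) t \<omega>"
  unfolding hist_def history_def fun_eq_iff prod_eq_iff by auto

lemma sets_history: "{\<omega>\<in>space M. history g Gsize p \<nu> \<pi> t \<omega>} \<in> events"
proof -
  note [measurable] = measurable_p
  have [measurable]: "(\<lambda>\<omega>. Gsize h s \<omega> = c) \<in> measurable M (count_space UNIV)" if "h \<in> {1..g}" for h s c
    using measurable_Gsize[OF that, of s] by measurable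
  show ?thesis
    unfolding history_def by measurable
qed

lemma sets_chosen: "{\<omega>\<in>space M. chosen h t \<omega>} \<in> events"
proof -
  note [measurable] = measurable_p
  have price: "{\<omega>\<in>space M. p (t + 1) \<omega> = c * p t \<omega>} \<in> events" for c
    by measurable
  have size: "{\<omega>\<in>space M. Gsize i t \<omega> = Gsize i (t + 1) \<omega> + c} \<in> events" if "i \<in> {1..g}" for i c
  proof -
    have [measurable]: "(\<lambda>\<omega>. Gsize i s \<omega> = m) \<in> measurable M (count_space UNIV)" for s m
      using measurable_Gsize[OF that, of s] by measurable
    \<comment> \<open>Naming the common value turns the comparison of two random sizes into a
      countable union.\<close>
    have "{\<omega>\<in>space M. \<exists>m. Gsize i (t + 1) \<omega> = m \<and> Gsize i t \<omega> = m + c} \<in> events"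
      by measurable
    then show ?thesis by simp
  qed
  show ?thesis
    unfolding chosen_def by (intro sets.sets_Collect_conj sets.sets_Collect_finite_All price size) auto
qed

lemma sets_hist: "{\<omega>\<in>space M. hist t \<omega> = c} \<in> events"
proof (cases "\<exists>\<omega>'. c = hist t \<omega>'")
  case True
  then show ?thesis using sets_history by (auto simp: hist_eq_iff)
next
  case False
  then have "{\<omega>\<in>space M. hist t \<omega> = c} = {}" by auto
  then show ?thesis by (metis sets.empty_sets)
qed

lemma sets_chosen_hist: "{\<omega>\<in>space M. chosen h t \<omega> \<and> hist t \<omega> = c} \<in> events"
  using sets.sets_Collect_conj[OF sets_hist sets_chosen] .

text \<open>Multiplied-out form of the model's conditional probabilities, which also covers
  histories of probability 0.\<close>

lemma prob_chosen_hist: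
  assumes h: "h \<le> g"
  shows "\<P>(\<omega> in M. chosen h t \<omega> \<and> hist t \<omega> = hist t \<omega>') = rate h (sold t \<omega>') * \<P>(\<omega> in M. hist t \<omega> = hist t \<omega>')"
proof (cases "\<P>(\<omega> in M. hist t \<omega> = hist t \<omega>') = 0")
  case True
  have "\<P>(\<omega> in M. chosen h t \<omega> \<and> hist t \<omega> = hist t \<omega>') \<le> \<P>(\<omega> in M. hist t \<omega> = hist t \<omega>')"
    using sets_hist by (intro finite_measure_mono) auto
  with True show ?thesis by (simp add: antisym)
next
  case False
  let ?\<nu> = "fst (hist t \<omega>')" and ?\<pi> = "snd (hist t \<omega>')"
  have pos: "\<P>(\<omega> in M. history g Gsize p ?\<nu> ?\<pi> t \<omega>) > 0"
    using False by (simp add: hist_eq_iff zero_less_measure_iff)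
  have "\<P>(\<omega> in M. chosen h t \<omega> \<bar> history g Gsize p ?\<nu> ?\<pi> t \<omega>) = rate h (sold t \<omega>')"
  proof (cases "h = 0")
    case True
    have "chosen h t = (\<lambda>\<omega>. p (t + 1) \<omega> = p t \<omega> \<and> (\<forall>i\<in>{1..g}. Gsize i (t + 1) \<omega> = Gsize i t \<omega>))"
      using True by (force simp: chosen_def fun_eq_iff)
    then show ?thesis
      using inactive_chosen[OF pos] True by (simp add: rate_def sold_def hist_def)
  next
    case False
    with h have hg: "h \<in> {1..g}" by simp
    have "chosen h t = (\<lambda>\<omega>. p (t + 1) \<omega> = f h * p t \<omega> \<and> Gsize h t \<omega> = Gsize h (t + 1) \<omega> + 1 \<and>
        (\<forall>i\<in>{1..g} - {h}. Gsize i (t + 1) \<omega> = Gsize i t \<omega>))"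
      using False hg by (force simp: chosen_def fun_eq_iff)
    then show ?thesis
      using active_chosen[OF hg pos] False hg by (simp add: rate_def sold_def hist_def)
  qed
  then show ?thesis
    using pos by (simp add: cond_prob_def hist_eq_iff field_simps)
qed

lemma chosen_unique: "chosen h t \<omega> \<Longrightarrow> chosen h' t \<omega> \<Longrightarrow> h \<le> g \<Longrightarrow> h' \<le> g \<Longrightarrow> h = h'"
proof (rule ccontr)
  assume *: "chosen h t \<omega>" "chosen h' t \<omega>" "h \<le> g" "h' \<le> g" "h \<noteq> h'"
  \<comment> \<open>The larger index is a genuine group, and the two transitions disagree on its
    size. The price is not consulted, so \<open>f h = 1\<close> is harmless.\<close>
  define i where "i = max h h'"
  have "i \<in> {1..g}" "of_bool (i = h) \<noteq> (of_bool (i = h') :: nat)"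
    using * by (auto simp: i_def max_def)
  with * show False unfolding chosen_def by fastforce
qed

lemma sold_Suc:
  assumes "chosen h t \<omega>" "h \<le> g"
  shows "sold (Suc t) \<omega> = sell h (sold t \<omega>)"
proof
  fix i
  show "sold (Suc t) \<omega> i = sell h (sold t \<omega>) i"
  proof (cases "i \<in> {1..g}")
    case True
    then have "Gsize i t \<omega> = Gsize i (Suc t) \<omega> + of_bool (i = h)"
      using assms by (auto simp: chosen_def)
    then show ?thesis using True by (auto simp: sold_def sell_def)
  qed (use assms in \<open>auto simp: sold_def sell_def\<close>)
qed

section \<open>Almost surely finitely many histories\<close>

text \<open>Within each history the disjoint transitions exhaust its probability because the rates
  sum to 1. Finiteness is assumed for the current time only, so that \<open>finite_hist\<close> can
  use this in its induction.\<close>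

lemma AE_chosen_if_finite_hist:
  assumes N: "N \<ge> 1" and S: "finite S" and AE: "AE \<omega> in M. hist t \<omega> \<in> S"
  shows "AE \<omega> in M. \<exists>h\<le>g. chosen h t \<omega>"
proof -
  have "AE \<omega> in M. hist t \<omega> = c \<longrightarrow> (\<exists>h\<le>g. chosen h t \<omega>)" for c
  proof (cases "\<exists>\<omega>'. c = hist t \<omega>'")
    case True
    then obtain \<omega>' where c: "c = hist t \<omega>'" by blast
    let ?E = "\<lambda>h. {\<omega>\<in>space M. chosen h t \<omega> \<and> hist t \<omega> = c}"
    let ?B = "{\<omega>\<in>space M. hist t \<omega> = c}"
    have U: "(\<Union>h\<in>{..g}. ?E h) \<in> events"
      using sets_chosen_hist by (intro sets.finite_UN) auto
    have "prob (\<Union>h\<in>{..g}. ?E h) = (\<Sum>h\<le>g. prob (?E h))"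
    proof (rule finite_measure_finite_Union)
      show "?E ` {..g} \<subseteq> events" using sets_chosen_hist by blast
      show "disjoint_family_on ?E {..g}"
        using chosen_unique by (fastforce simp: disjoint_family_on_def)
    qed simp
    also have "\<dots> = prob ?B"
      using sum_rate[OF N] by (simp add: c prob_chosen_hist flip: sum_distrib_right)
    finally have "prob (?B - (\<Union>h\<in>{..g}. ?E h)) = 0"
      using U sets_hist by (subst finite_measure_Diff) auto
    then have "?B - (\<Union>h\<in>{..g}. ?E h) \<in> null_sets M"
      using U sets_hist by (auto simp: null_sets_def emeasure_eq_measure)
    then show ?thesis by (rule AE_I') auto
  qed auto
  then have "AE \<omega> in M. \<forall>c\<in>S. hist t \<omega> = c \<longrightarrow> (\<exists>h\<le>g. chosen h t \<omega>)"
    using S by (intro AE_finite_allI)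
  with AE show ?thesis by eventually_elim auto
qed

lemma finite_hist:
  assumes N: "N \<ge> 1"
  shows "\<exists>S. finite S \<and> (AE \<omega> in M. hist t \<omega> \<in> S)"
proof (induction t)
  case 0
  have "AE \<omega> in M. hist 0 \<omega> \<in> {((\<lambda>h s. if h \<in> {1..g} \<and> s = 0 then N0 h else 0), (\<lambda>s. if s = 0 then p0 else 0))}"
    using initial by eventually_elim (auto simp: hist_def fun_eq_iff)
  then show ?case by blast
next
  case (Suc t)
  then obtain S where S: "finite S" "AE \<omega> in M. hist t \<omega> \<in> S" by blast
  define ext where "ext = (\<lambda>((\<nu>, \<pi>), h).
     ((\<lambda>i. (\<nu> i)(Suc t := \<nu> i t - of_bool (i = h)) :: nat \<Rightarrow> nat),
      \<pi>(Suc t := (if h = 0 then 1 else f h) * \<pi> t)))"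
  have "AE \<omega> in M. hist (Suc t) \<omega> \<in> ext ` (S \<times> {..g})"
    using S(2) AE_chosen_if_finite_hist[OF N S]
  proof eventually_elim
    case (elim \<omega>)
    then obtain h where h: "h \<le> g" "chosen h t \<omega>" by blast
    have "hist (Suc t) \<omega> = ext (hist t \<omega>, h)"
      using h(2) by (auto simp: ext_def hist_def chosen_def fun_eq_iff le_Suc_eq)
    then show ?case using elim h by blast
  qed
  moreover have "finite (ext ` (S \<times> {..g}))" using S(1) by simp
  ultimately show ?case by (intro exI[of _ "ext ` (S \<times> {..g})"] conjI)
qed

lemma AE_chosen:
  assumes N: "N \<ge> 1"
  shows "AE \<omega> in M. \<exists>h\<le>g. chosen h t \<omega>"
proof -
  obtain S where "finite S" "AE \<omega> in M. hist t \<omega> \<in> S"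
    using finite_hist[OF N] by blast
  with N show ?thesis by (rule AE_chosen_if_finite_hist)
qed

section \<open>Expectations as finite sums over histories\<close>

text \<open>An arbitrary \<open>\<phi>\<close> is allowed because the vector of sizes takes values
  in a countable discrete space.\<close>

lemma measurable_sold:
  fixes \<phi> :: "(nat \<Rightarrow> real) \<Rightarrow> real"
  shows "(\<lambda>\<omega>. \<phi> (sold t \<omega>)) \<in> borel_measurable M"
proof -
  define V where "V = (\<lambda>\<omega>. \<lambda>h\<in>{1..g}. Gsize h t \<omega>)"
  let ?A = "{1..g} \<rightarrow>\<^sub>E (UNIV :: nat set)"
  have "V -` {a} \<inter> space M \<in> events" if "a \<in> ?A" for a
  proof -
    have [measurable]: "(\<lambda>\<omega>. Gsize h t \<omega> = c) \<in> measurable M (count_space UNIV)" if "h \<in> {1..g}" for h c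
      using measurable_Gsize[OF that, of t] by measurable
    have "V -` {a} \<inter> space M = {\<omega>\<in>space M. \<forall>h\<in>{1..g}. Gsize h t \<omega> = a h}"
      using that by (auto simp: V_def PiE_iff extensional_def fun_eq_iff)
    also have "\<dots> \<in> events" by measurable
    finally show ?thesis .
  qed
  then have "V \<in> measurable M (count_space ?A)"
    by (subst measurable_count_space_eq_countable) (auto simp: V_def intro: countable_PiE)
  moreover have "(\<lambda>v. \<phi> (\<lambda>h\<in>{1..g}. real (N0 h) - real (v h))) \<in> measurable (count_space ?A) borel"
    by simp
  ultimately have "(\<lambda>\<omega>. \<phi> (\<lambda>h\<in>{1..g}. real (N0 h) - real (V \<omega> h))) \<in> borel_measurable M"
    by (rule measurable_compose)
  moreover have "(\<lambda>h\<in>{1..g}. real (N0 h) - real (V \<omega> h)) = sold t \<omega>" for \<omega>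
    unfolding V_def sold_def by (rule restrict_ext) simp
  ultimately show ?thesis by simp
qed

definition hist_sold :: "nat \<Rightarrow> (nat \<Rightarrow> nat \<Rightarrow> nat) \<times> (nat \<Rightarrow> real) \<Rightarrow> nat \<Rightarrow> real" where
  "hist_sold t c = (\<lambda>h\<in>{1..g}. real (N0 h) - real (fst c h t))"

lemma hist_sold_hist [simp]: "hist_sold t (hist t \<omega>) = sold t \<omega>"
  by (auto simp: hist_sold_def hist_def sold_def fun_eq_iff)


lemma has_expectation_sold:
  fixes \<phi> :: "(nat \<Rightarrow> real) \<Rightarrow> real"
  assumes S: "finite S" "AE \<omega> in M. hist t \<omega> \<in> S"
  shows "has_bochner_integral M (\<lambda>\<omega>. \<phi> (sold t \<omega>)) (\<Sum>c\<in>S. \<P>(\<omega> in M. hist t \<omega> = c) * \<phi> (hist_sold t c))"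
proof -
  let ?B = "\<lambda>c. {\<omega>\<in>space M. hist t \<omega> = c}"
  let ?s = "\<lambda>\<omega>. \<Sum>c\<in>S. indicator (?B c) \<omega> * \<phi> (hist_sold t c)"
  have s: "has_bochner_integral M ?s (\<Sum>c\<in>S. measure M (?B c) * \<phi> (hist_sold t c))"
    using sets_hist
    by (intro has_bochner_integral_sum has_bochner_integral_mult_left has_bochner_integral_real_indicator)
       (auto simp: emeasure_eq_measure)
  have "AE \<omega> in M. \<phi> (sold t \<omega>) = ?s \<omega>"
    using S(2) AE_space
  proof eventually_elim
    case (elim \<omega>)
    have "?s \<omega> = (\<Sum>c\<in>S. if c = hist t \<omega> then \<phi> (hist_sold t c) else 0)"
      using elim by (intro sum.cong) (auto simp: indicator_def)
    then show ?case using elim S(1) by simp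
  qed
  then show ?thesis
    using s by (subst has_bochner_integral_cong_AE[OF measurable_sold borel_measurable_has_bochner_integral[OF s]])
qed

text \<open>The Markov property in expectation: split by history and chosen transition, and use that
  the rate depends on the history only through \<open>sold\<close>.\<close>

lemma expectation_sold_Suc:
  fixes \<phi> :: "(nat \<Rightarrow> real) \<Rightarrow> real"
  assumes N: "N \<ge> 1"
  shows "expectation (\<lambda>\<omega>. \<phi> (sold (Suc t) \<omega>)) = expectation (\<lambda>\<omega>. \<Sum>h\<le>g. rate h (sold t \<omega>) * \<phi> (sell h (sold t \<omega>)))"
proof -
  obtain S where S: "finite S" "AE \<omega> in M. hist t \<omega> \<in> S"
    using finite_hist[OF N] by blast
  let ?E = "\<lambda>c h. {\<omega>\<in>space M. chosen h t \<omega> \<and> hist t \<omega> = c}"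
  let ?s = "\<lambda>\<omega>. \<Sum>c\<in>S. \<Sum>h\<le>g. indicator (?E c h) \<omega> * \<phi> (sell h (hist_sold t c))"
  have s: "has_bochner_integral M ?s (\<Sum>c\<in>S. \<Sum>h\<le>g. measure M (?E c h) * \<phi> (sell h (hist_sold t c)))"
    using sets_chosen_hist
    by (intro has_bochner_integral_sum has_bochner_integral_mult_left has_bochner_integral_real_indicator)
       (auto simp: emeasure_eq_measure)
  have "AE \<omega> in M. \<phi> (sold (Suc t) \<omega>) = ?s \<omega>"
    using S(2) AE_chosen[OF N, of t] AE_space
  proof eventually_elim
    case (elim \<omega>)
    then obtain h where h: "h \<le> g" "chosen h t \<omega>" by blast
    \<comment> \<open>By \<open>chosen_unique\<close> only the transition that occurred
      contributes.\<close>
    have "(\<Sum>k\<le>g. indicator (?E c k) \<omega> * \<phi> (sell k (hist_sold t c)))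
        = (\<Sum>k\<le>g. if k = h then of_bool (c = hist t \<omega>) * \<phi> (sell k (hist_sold t c)) else 0)" for c
      using elim h by (intro sum.cong) (auto simp: indicator_def dest: chosen_unique)
    then have "?s \<omega> = (\<Sum>c\<in>S. if c = hist t \<omega> then \<phi> (sell h (hist_sold t c)) else 0)"
      using h by (auto intro!: sum.cong)
    then show ?case using elim S(1) by (simp add: sold_Suc[OF h(2,1)])
  qed
  then have "expectation (\<lambda>\<omega>. \<phi> (sold (Suc t) \<omega>)) = expectation ?s"
    by (rule integral_cong_AE[OF measurable_sold borel_measurable_has_bochner_integral[OF s]])
  also have "\<dots> = (\<Sum>c\<in>S. \<Sum>h\<le>g. measure M (?E c h) * \<phi> (sell h (hist_sold t c)))"
    using s by (rule has_bochner_integral_integral_eq)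
  also have "\<dots> = (\<Sum>c\<in>S. \<P>(\<omega> in M. hist t \<omega> = c) * (\<Sum>h\<le>g. rate h (hist_sold t c) * \<phi> (sell h (hist_sold t c))))"
  proof (rule sum.cong[OF refl])
    fix c
    have "measure M (?E c h) = rate h (hist_sold t c) * \<P>(\<omega> in M. hist t \<omega> = c)" if "h \<le> g" for h
    \<comment> \<open>\<open>S\<close> may contain values that no outcome attains; their events are
      empty.\<close>
    proof (cases "\<exists>\<omega>'. c = hist t \<omega>'")
      case True
      then show ?thesis using prob_chosen_hist[OF that] by auto
    next
      case False
      then have "?E c h = {}" "{\<omega>\<in>space M. hist t \<omega> = c} = {}" by auto
      then show ?thesis by (metis measure_empty mult_zero_right)
    qed
    then show "(\<Sum>h\<le>g. measure M (?E c h) * \<phi> (sell h (hist_sold t c))) =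
        \<P>(\<omega> in M. hist t \<omega> = c) * (\<Sum>h\<le>g. rate h (hist_sold t c) * \<phi> (sell h (hist_sold t c)))"
      by (simp add: sum_distrib_left mult_ac)
  qed
  also have "\<dots> = expectation (\<lambda>\<omega>. \<Sum>h\<le>g. rate h (sold t \<omega>) * \<phi> (sell h (sold t \<omega>)))"
    using has_expectation_sold[OF S, of "\<lambda>x. \<Sum>h\<le>g. rate h x * \<phi> (sell h x)"]
    by (rule has_bochner_integral_integral_eq[symmetric])
  finally show ?thesis .
qed

lemma integrable_sold:
  fixes \<phi> :: "(nat \<Rightarrow> real) \<Rightarrow> real"
  assumes N: "N \<ge> 1"
  shows "integrable M (\<lambda>\<omega>. \<phi> (sold t \<omega>))"
proof -
  obtain S where "finite S" "AE \<omega> in M. hist t \<omega> \<in> S"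
    using finite_hist[OF N] by blast
  then show ?thesis by (rule integrable.intros[OF has_expectation_sold])
qed

section \<open>Joint factorial moments\<close>

text \<open>The orders \<open>k\<close> stay arbitrary in the induction because the generator also
  produces moments of lowered orders.\<close>

lemma expectation_falling_sold:
  assumes N: "N \<ge> 1"
  shows "expectation (\<lambda>\<omega>. \<Prod>h=1..g. falling (sold t \<omega> h) (k h)) =
    (\<Prod>h=1..g. falling (real (N0 h)) (k h)) * thinning N t (\<Sum>h=1..g. k h)"
proof (induction t arbitrary: k)
  case 0
  have "AE \<omega> in M. (\<Prod>h=1..g. falling (sold 0 \<omega> h) (k h)) = (\<Prod>h=1..g. of_bool (k h = 0))"
    using initial by eventually_elim (auto simp: sold_def falling_0_left intro!: prod.cong)
  then have "expectation (\<lambda>\<omega>. \<Prod>h=1..g. falling (sold 0 \<omega> h) (k h)) = expectation (\<lambda>\<omega>. \<Prod>h=1..g. of_bool (k h = 0))"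
    by (intro integral_cong_AE measurable_sold) auto
  also have "\<dots> = (\<Prod>h=1..g. of_bool (k h = 0))"
    by (simp add: prob_space)
  also have "\<dots> = (\<Prod>h=1..g. falling (real (N0 h)) (k h)) * thinning N 0 (\<Sum>h=1..g. k h)"
    by (cases "\<forall>h\<in>{1..g}. k h = 0") (auto simp: thinning_0)
  finally show ?case .
next
  case (Suc t)
  let ?P = "\<lambda>k x. \<Prod>h=1..g. falling (x h) (k h)"
  let ?d = "\<lambda>h. k(h := k h - 1)"
  define K where "K = (\<Sum>h=1..g. k h)"
  define F where "F = (\<Prod>h=1..g. falling (real (N0 h)) (k h))"
  let ?w = "\<lambda>h. real (k h) * (real (N0 h) - (real (k h) - 1))"
  \<comment> \<open>Since the rates sum to 1, \<open>?P k x\<close> can be subtracted from every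
    term; the inactive choice \<open>h = 0\<close> then drops out.\<close>
  have generator: "(\<Sum>h\<le>g. rate h x * ?P k (sell h x)) =
      (1 - real K / real N) * ?P k x + (\<Sum>h=1..g. ?w h * ?P (?d h) x) / real N" for x
  proof -
    have "(\<Sum>h\<le>g. rate h x * ?P k (sell h x)) = (\<Sum>h\<le>g. rate h x) * ?P k x + (\<Sum>h\<le>g. rate h x * (?P k (sell h x) - ?P k x))"
      by (simp add: sum_distrib_right algebra_simps flip: sum.distrib)
    also have "(\<Sum>h\<le>g. rate h x * (?P k (sell h x) - ?P k x)) = (\<Sum>h=1..g. rate h x * (?P k (sell h x) - ?P k x))"
      by (intro sum.mono_neutral_right) (auto simp: sell_def not_le)
    also have "\<dots> = (\<Sum>h=1..g. (real (N0 h) - x h) * (?P k (x(h := x h + 1)) - ?P k x)) / real N"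
      unfolding sum_divide_distrib by (intro sum.cong) (auto simp: rate_def sell_def)
    also have "\<dots> = ((\<Sum>h=1..g. ?w h * ?P (?d h) x) - real K * ?P k x) / real N"
      unfolding K_def by (subst falling_sum_generator) auto
    finally show ?thesis
      by (simp add: sum_rate[OF N] algebra_simps diff_divide_distrib)
  qed
  \<comment> \<open>The weight supplies the factor \<open>N0 h - (k h - 1)\<close> lost by lowering
    \<open>k h\<close>, which completes the product to \<open>F\<close>. What multiplies
    \<open>k h\<close> no longer depends on \<open>h\<close>, so summation gives
    \<open>K\<close>.\<close>
  have drop: "?w h * (?P (?d h) (\<lambda>h. real (N0 h)) * thinning N t (\<Sum>i=1..g. ?d h i)) = real (k h) * (F * thinning N t (K - 1))"
    if h: "h \<in> {1..g}" for h
  proof (cases "k h = 0")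
    case False
    have "(\<Sum>i=1..g. ?d h i) = ?d h h + (\<Sum>i\<in>{1..g} - {h}. ?d h i)"
      "K = k h + (\<Sum>i\<in>{1..g} - {h}. k i)"
      unfolding K_def using h by (intro sum.remove; simp)+
    moreover have "(\<Sum>i\<in>{1..g} - {h}. ?d h i) = (\<Sum>i\<in>{1..g} - {h}. k i)"
      by (intro sum.cong) auto
    ultimately have K: "(\<Sum>i=1..g. ?d h i) = K - 1" using False by simp
    have "?P (?d h) (\<lambda>h. real (N0 h)) =
        falling (real (N0 h)) (?d h h) * (\<Prod>i\<in>{1..g} - {h}. falling (real (N0 i)) (?d h i))"
      and F: "F = falling (real (N0 h)) (k h) * (\<Prod>i\<in>{1..g} - {h}. falling (real (N0 i)) (k i))"
      unfolding F_def using h by (intro prod.remove; simp)+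
    moreover have "(\<Prod>i\<in>{1..g} - {h}. falling (real (N0 i)) (?d h i)) =
        (\<Prod>i\<in>{1..g} - {h}. falling (real (N0 i)) (k i))"
      by (intro prod.cong) auto
    ultimately have P: "?P (?d h) (\<lambda>h. real (N0 h)) =
        falling (real (N0 h)) (k h - 1) * (\<Prod>i\<in>{1..g} - {h}. falling (real (N0 i)) (k i))"
      by simp
    show ?thesis
      unfolding K F P using False falling_absorb[of "k h" "real (N0 h)"] by (auto simp: mult_ac)
  qed simp
  have "expectation (\<lambda>\<omega>. ?P k (sold (Suc t) \<omega>)) = expectation (\<lambda>\<omega>. \<Sum>h\<le>g. rate h (sold t \<omega>) * ?P k (sell h (sold t \<omega>)))"
    using expectation_sold_Suc[OF N, of "?P k" t] .
  also have "\<dots> = expectation (\<lambda>\<omega>. (1 - real K / real N) * ?P k (sold t \<omega>) + (\<Sum>h=1..g. ?w h * ?P (?d h) (sold t \<omega>)) / real N)"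
    unfolding generator ..
  also have "\<dots> = (1 - real K / real N) * expectation (\<lambda>\<omega>. ?P k (sold t \<omega>)) +
      (\<Sum>h=1..g. ?w h * expectation (\<lambda>\<omega>. ?P (?d h) (sold t \<omega>))) / real N"
    using integrable_sold[OF N, of "?P _" t] by simp
  also have "\<dots> = (1 - real K / real N) * (F * thinning N t K) + (\<Sum>h=1..g. real (k h) * (F * thinning N t (K - 1))) / real N"
    unfolding Suc.IH F_def[symmetric] K_def[symmetric] by (simp only: sum.cong[OF refl drop])
  also have "(\<Sum>h=1..g. real (k h) * (F * thinning N t (K - 1))) = real K * (F * thinning N t (K - 1))"
    by (simp add: K_def sum_distrib_right)
  also have "(1 - real K / real N) * (F * thinning N t K) + real K * (F * thinning N t (K - 1)) / real N =
      F * thinning N (Suc t) K"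
    by (simp add: thinning_Suc algebra_simps)
  finally show ?case by (simp add: F_def K_def)
qed

section \<open>The logarithm of the price and the moment formula\<close>

text \<open>Positivity is carried through the induction because the logarithm of the product is
  split at each step.\<close>

lemma AE_log_price:
  assumes N: "N \<ge> 1" and f: "\<And>h. h \<in> {1..g} \<Longrightarrow> f h > 0" and p0: "p0 > 0"
  shows "AE \<omega> in M. p t \<omega> > 0 \<and> p 0 \<omega> > 0 \<and> ln (p t \<omega> / p 0 \<omega>) = (\<Sum>h=1..g. sold t \<omega> h * ln (f h))"
proof (induction t)
  case 0
  show ?case using initial by eventually_elim (use p0 in \<open>simp add: sold_def\<close>)
next
  case (Suc t)
  show ?case using Suc AE_chosen[OF N, of t]
  proof eventually_elim
    case (elim \<omega>)
    then obtain h where h: "h \<le> g" "chosen h t \<omega>" by blast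
    show ?case
    proof (cases "h = 0")
      case True
      then have "p (Suc t) \<omega> = p t \<omega>" "sold (Suc t) \<omega> = sold t \<omega>"
        using h sold_Suc[OF h(2,1)] by (auto simp: chosen_def sell_def)
      then show ?thesis using elim by simp
    next
      case False
      then have hg: "h \<in> {1..g}" using h by simp
      have p: "p (Suc t) \<omega> = f h * p t \<omega>" and s: "sold (Suc t) \<omega> = (sold t \<omega>)(h := sold t \<omega> h + 1)"
        using h False sold_Suc[OF h(2,1)] by (auto simp: chosen_def sell_def)
      have "(\<Sum>i=1..g. sold (Suc t) \<omega> i * ln (f i)) = (\<Sum>i=1..g. sold t \<omega> i * ln (f i) + (if i = h then ln (f h) else 0))"
        by (intro sum.cong) (auto simp: s algebra_simps)
      then have "(\<Sum>i=1..g. sold (Suc t) \<omega> i * ln (f i)) = (\<Sum>i=1..g. sold t \<omega> i * ln (f i)) + ln (f h)"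
        using hg by (simp add: sum.distrib)
      moreover have "ln (f h * (p t \<omega> / p 0 \<omega>)) = ln (f h) + ln (p t \<omega> / p 0 \<omega>)"
        using elim f[OF hg] by (intro ln_mult_pos) auto
      ultimately show ?thesis
        using elim f[OF hg] by (simp add: p)
    qed
  qed
qed

end

theorem mainTheorem4:
  fixes M :: "'a measure"
    and g N n t :: nat
    and f :: "nat \<Rightarrow> real"
    and N0 :: "nat \<Rightarrow> nat"
    and p0 :: real
    and Gsize :: "nat \<Rightarrow> nat \<Rightarrow> 'a \<Rightarrow> nat"
    and p :: "nat \<Rightarrow> 'a \<Rightarrow> real"
  assumes "g \<ge> 1" and "N \<ge> 1"
    and "\<And>h. h \<in> {1..g} \<Longrightarrow> N0 h \<ge> 1"
    and "(\<Sum>h=1..g. N0 h) \<le> N"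
    and "\<And>h. h \<in> {1..g} \<Longrightarrow> f h > 0"
    and "strict_mono_on {1..g} f"
    and "p0 > 0"
    and "multi_group_model M g N f N0 p0 Gsize p"
    and "n \<ge> 1"
  shows "integrable M (\<lambda>\<omega>. (ln (p t \<omega> / p 0 \<omega>)) ^ n) \<and>
    (\<integral>\<omega>. (ln (p t \<omega> / p 0 \<omega>)) ^ n \<partial>M) =
      (\<Sum>m\<in>weak_compositions g n.
         fact n / (\<Prod>h=1..g. fact (m h)) * (\<Prod>h=1..g. ln (f h) ^ m h) *
         (\<Sum>k\<in>(\<Pi>\<^sub>E h\<in>{1..g}. {0..m h}).
            (\<Prod>h=1..g. falling_factorial (N0 h) (k h) * real (Stirling (m h) (k h))) *
            (\<Sum>j=0..(\<Sum>h=1..g. k h).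
               (-1) ^ j * real ((\<Sum>h=1..g. k h) choose j) * (1 - real j / real N) ^ t)))"
proof -
  interpret multi_group_model M g N f N0 p0 Gsize p by fact
  let ?L = "\<lambda>\<omega>. ln (p t \<omega> / p 0 \<omega>)"
  let ?c = "\<lambda>m. fact n / (\<Prod>h=1..g. fact (m h)) * (\<Prod>h=1..g. ln (f h) ^ m h)"
  let ?S = "\<lambda>m k. \<Prod>h=1..g. real (Stirling (m h) (k h))"
  let ?K = "\<lambda>m. \<Pi>\<^sub>E h\<in>{1..g}. {0..m h}"
  let ?P = "\<lambda>k x. \<Prod>h=1..g. falling (x h) (k h)"
  let ?\<phi> = "\<lambda>x. \<Sum>m\<in>weak_compositions g n. ?c m * (\<Sum>k\<in>?K m. ?S m k * ?P k x)"
  \<comment> \<open>A pointwise identity whose right side is linear in the products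
    \<open>?P k x\<close>, so that only their expectations are needed.\<close>
  have expand: "(\<Sum>h=1..g. x h * ln (f h)) ^ n = ?\<phi> x" for x
  proof -
    have "(\<Sum>h=1..g. x h * ln (f h)) ^ n = fact n * ((\<Sum>h=1..g. x h * ln (f h)) ^ n / fact n)"
      by simp
    also have "\<dots> = (\<Sum>m\<in>weak_compositions g n. fact n * (\<Prod>h=1..g. (x h * ln (f h)) ^ m h / fact (m h)))"
      by (subst multinomial_divided) (auto simp: weak_compositions_def sum_distrib_left)
    also have "\<dots> = (\<Sum>m\<in>weak_compositions g n. ?c m * (\<Prod>h=1..g. x h ^ m h))"
      by (simp add: power_mult_distrib prod.distrib prod_dividef mult_ac)
    also have "\<dots> = ?\<phi> x"
      \<comment> \<open>The product over groups of sums over orders becomes one sum over functions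
        \<open>k\<close>.\<close>
      unfolding power_eq_sum_Stirling_falling
      by (simp add: prod_sum_PiE prod.distrib atLeast0AtMost)
    finally show ?thesis .
  qed
  have p_meas: "(\<lambda>\<omega>. ?L \<omega> ^ n) \<in> borel_measurable M"
    using measurable_p[of t] measurable_p[of 0] by measurable
  have "AE \<omega> in M. p t \<omega> > 0 \<and> p 0 \<omega> > 0 \<and> ?L \<omega> = (\<Sum>h=1..g. sold t \<omega> h * ln (f h))"
    using assms by (intro AE_log_price) auto
  then have AE: "AE \<omega> in M. ?L \<omega> ^ n = ?\<phi> (sold t \<omega>)"
  proof eventually_elim
    case (elim \<omega>)
    then show ?case by (simp only: expand)
  qed
  have "integrable M (\<lambda>\<omega>. ?L \<omega> ^ n)"
    using integrable_sold[OF assms(2), of ?\<phi> t] integrable_cong_AE[OF p_meas measurable_sold[of ?\<phi> t] AE] by simp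
  moreover have "(\<integral>\<omega>. ?L \<omega> ^ n \<partial>M) = (\<integral>\<omega>. ?\<phi> (sold t \<omega>) \<partial>M)"
    by (rule integral_cong_AE[OF p_meas measurable_sold[of ?\<phi> t] AE])
  moreover have "(\<integral>\<omega>. ?\<phi> (sold t \<omega>) \<partial>M) =
      (\<Sum>m\<in>weak_compositions g n. ?c m * (\<Sum>k\<in>?K m. ?S m k * (\<integral>\<omega>. ?P k (sold t \<omega>) \<partial>M)))"
    using integrable_sold[OF assms(2), of "?P _" t] by simp
  ultimately show ?thesis
    \<comment> \<open>At \<open>real (N0 h)\<close> the real-argument \<open>falling\<close> is
      \<open>falling_factorial\<close> by definition.\<close>
    unfolding expectation_falling_sold[OF assms(2)]
    by (simp add: thinning_def falling_def falling_factorial_def prod.distrib atLeast0AtMost mult_ac)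
qed

end
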